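(* Let $G=(V,E)$ be a finite graph (loops and multiple edges allowed) with complex edge weights $\lambda=\{\lambda_e:e\in E\}$. For each vertex $v\in V$ with $d=\deg(G,v)$, let $u^{(v)}=(u^{(v)}_0,\dots,u^{(v)}_d)$ be complex numbers (vertex activities), and define the key polynomial $K_v(z)=\sum_{j=0}^{d}\binom{d}{j}u^{(v)}_j z^j$. Define $$Z(G,\lambda,u;\mathbf{x})=\sum_{H\subseteq E}\Big(\prod_{e\in H}\lambda_e\Big)\Big(\prod_{v\in V}u^{(v)}_{\deg(H,v)}\Big)\prod_{v\in V}x_v^{\deg(H,v)},$$ a polynomial in complex variables $\mathbf{x}=\{x_v:v\in V\}$, where the sum is over all edge subsets $H$ (spanning subgraphs $(V,H)$) and $\deg(H,v)$ is the degree of $v$ in $(V,H)$. Then: (a) Fix $0\leq\alpha<\pi/2$. If $\lambda_e$ is a nonnegative real number for each $e\in E$ and $K_v(z)$ is $S[\pi-\alpha]$-nonvanishing for each $v\in V$, then $Z(G,\lambda,u;\mathbf{x})$ is $S[\pi/2-\alpha]$-nonvanishing. (b) Fix $\kappa>0$ and $\lambda_{\max}>0$. If $|\lambda_e|\leq\lambda_{\max}$ for each $e\in E$ and $K_v(z)$ is $\kappa\mathcal{D}$-nonvanishing for each $v\in V$, then $Z(G,\lambda,u;\mathbf{x})$ is $(\kappa/\lambda_{\max}^{1/2})\mathcal{D}$-nonvanishing. (c) Fix $\kappa>0$ and $\lambda_{\min}>0$. If $|\lambda_e|\geq\lambda_{\min}$ for each $e\in E$, and for each $v\in V$ the polynomial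 $K_v(z)$ is $\kappa\mathcal{E}$-nonvanishing and has degree exactly $\deg(G,v)$, then $Z(G,\lambda,u;\mathbf{x})$ is $(\kappa/\lambda_{\min}^{1/2})\mathcal{E}$-nonvanishing.
   Context: Degrees count a loop twice at its vertex. For $\mathcal{A}\subseteq\mathbb{C}$, a polynomial $F$ in variables $\{z_v:v\in U\}$ is $\mathcal{A}$-nonvanishing if either $F\equiv 0$, or $F\neq 0$ whenever $z_v\in\mathcal{A}$ for all $v\in U$ (for a univariate polynomial, $U$ has one element). For $0<\theta\leq\pi$, $S[\theta]=\{z\in\mathbb{C}: z\neq 0,\ |\arg z|<\theta\}$ with $-\pi<\arg z\leq\pi$. For $\kappa>0$, $\kappa\mathcal{D}=\{z:|z|<\kappa\}$ and $\kappa\mathcal{E}=\{z:|z|>\kappa\}$. *)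

theory Defs
  imports "HOL-Analysis.Analysis" "HOL-Computational_Algebra.Polynomial"
begin

text \<open>
  A finite undirected multigraph: edges are abstract names in \<open>E\<close>, and \<open>ends e\<close> is the
  two-element multiset of endpoints of \<open>e\<close>. A loop at \<open>v\<close> has \<open>ends e = {#v, v#}\<close>;
  distinct elements of \<open>E\<close> with equal \<open>ends\<close> are parallel edges.
\<close>

locale finite_multigraph =
  fixes V :: "'v set" and E :: "'e set" and ends :: "'e \<Rightarrow> 'v multiset"
  assumes finite_V: "finite V"
    and finite_E: "finite E"
    and size_ends: "e \<in> E \<Longrightarrow> size (ends e) = 2"
    and ends_in_V: "e \<in> E \<Longrightarrow> set_mset (ends e) \<subseteq> V"

text \<open>Degree of \<open>v\<close> in the spanning subgraph with edge set \<open>H\<close>; a loop contributes 2.\<close>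

definition deg :: "('e \<Rightarrow> 'v multiset) \<Rightarrow> 'e set \<Rightarrow> 'v \<Rightarrow> nat" where
  "deg ends H v = (\<Sum>e\<in>H. count (ends e) v)"

definition key_poly :: "nat \<Rightarrow> (nat \<Rightarrow> complex) \<Rightarrow> complex poly" where
  "key_poly d u = (\<Sum>j\<le>d. monom (of_nat (d choose j) * u j) j)"

definition Z :: "'v set \<Rightarrow> 'e set \<Rightarrow> ('e \<Rightarrow> 'v multiset) \<Rightarrow> ('e \<Rightarrow> complex) \<Rightarrow>
    ('v \<Rightarrow> nat \<Rightarrow> complex) \<Rightarrow> ('v \<Rightarrow> complex) \<Rightarrow> complex" where
  "Z V E ends lam u x =
     (\<Sum>H\<in>Pow E. (\<Prod>e\<in>H. lam e) * (\<Prod>v\<in>V. u v (deg ends H v)) * (\<Prod>v\<in>V. x v ^ deg ends H v))"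

text \<open>
  A polynomial in the variables \<open>z\<^sub>v\<close>, \<open>v \<in> U\<close>, is represented by its polynomial function of
  \<open>z :: 'v \<Rightarrow> complex\<close>, which ignores \<open>z v\<close> for \<open>v \<notin> U\<close>. Since the complex field is infinite,
  the polynomial is zero iff this function is identically zero.
\<close>

definition nonvanishing :: "complex set \<Rightarrow> 'v set \<Rightarrow> (('v \<Rightarrow> complex) \<Rightarrow> complex) \<Rightarrow> bool" where
  "nonvanishing A U F \<longleftrightarrow>
     (\<forall>z. F z = 0) \<or> (\<forall>z. (\<forall>v\<in>U. z v \<in> A) \<longrightarrow> F z \<noteq> 0)"

text \<open>The univariate case, with a one-element set of variables.\<close>

definition poly_nonvanishing :: "complex set \<Rightarrow> complex poly \<Rightarrow> bool" where
  "poly_nonvanishing A p \<longleftrightarrow> nonvanishing A {()} (\<lambda>z. poly p (z ()))"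

text \<open>\<^const>\<open>Arg\<close> takes values in the interval from \<open>-pi\<close> (excluded) to \<open>pi\<close> (included).\<close>

definition sector :: "real \<Rightarrow> complex set" where
  "sector \<theta> = {z. z \<noteq> 0 \<and> \<bar>Arg z\<bar> < \<theta>}"

definition disc :: "real \<Rightarrow> complex set" where
  "disc \<kappa> = {z. norm z < \<kappa>}"

definition exterior :: "real \<Rightarrow> complex set" where
  "exterior \<kappa> = {z. norm z > \<kappa>}"

end

theory Submission
  imports Defs "HOL-Complex_Analysis.Great_Picard"
    "HOL-Computational_Algebra.Fundamental_Theorem_Algebra"
begin

text \<open>
  Give every half-edge \<open>h\<close> at \<open>v\<close> its own variable \<open>y\<^sub>h\<close> and replace \<open>K\<^sub>v(x\<^sub>v y)\<close> by its
  symmetric multiaffine polarization in the half-edges at \<open>v\<close>, which inherits nonvanishing on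
  discs by the Grace-Walsh-Szego theorem. The product over all vertices is multiaffine, and
  \<open>Z\<close> arises from it by Asano contractions \<open>a + b y + c y' + d y y' \<mapsto> a + \<lambda>\<^sub>e d\<close>, one for every
  edge. Each contraction preserves nonvanishing on a closed set \<open>C\<close>: a disc in (b), the closed
  right half-plane in (a). Part (c) is (b) for the complementary subgraphs \<open>E - H\<close>. In (a) the
  half-plane touches the boundary of the allowed region, so the argument is applied to
  \<open>K\<^sub>v(z + \<epsilon>)\<close>, and Hurwitz's theorem yields the limit \<open>\<epsilon> \<rightarrow> 0\<close>.
\<close>

section \<open>Laguerre's theorem and the Grace-Walsh-Szego theorem for balls\<close>

text \<open>The ball of radius \<open>r\<close> around \<open>- a\<close> contains 0, so
  \<open>t \<mapsto> 1 / t\<close> sends its exterior to a bounded disc, with centre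
  \<open>cnj a / k\<close> and radius \<open>r / k\<close>. After squaring, both inequalities reduce
  to k \<le> |t|^2 + 2 Re (cnj a * t).\<close>

lemma inversion_disc:
  fixes a t :: complex and r :: real
  defines "k \<equiv> r\<^sup>2 - (norm a)\<^sup>2"
  assumes "norm a < r" "t \<noteq> 0"
  shows "norm (1 / t - cnj a / of_real k) \<le> r / k \<longleftrightarrow> r \<le> norm (a + t)"
proof -
  have r: "r > 0" using assms(2) norm_ge_zero[of a] by linarith
  have k: "k > 0" using assms(2) by (simp add: k_def power_strict_mono)
  have "1 / t - cnj a / of_real k = (of_real k - cnj a * t) / (of_real k * t)"
    using k assms(3) by (simp add: field_simps)
  then have eq: "norm (1 / t - cnj a / of_real k) = norm (of_real k - cnj a * t) / (k * norm t)"
    using k by (simp add: norm_divide norm_mult)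
  have "norm (1 / t - cnj a / of_real k) \<le> r / k \<longleftrightarrow> norm (of_real k - cnj a * t) \<le> r * norm t"
    unfolding eq using k assms(3) by (simp add: divide_le_eq)
  also have "\<dots> \<longleftrightarrow> (norm (of_real k - cnj a * t))\<^sup>2 \<le> (r * norm t)\<^sup>2"
    using r by (intro power_mono_iff[symmetric]) auto
  also have "(norm (of_real k - cnj a * t))\<^sup>2 = k\<^sup>2 - 2 * k * Re (cnj a * t) + (norm a)\<^sup>2 * (norm t)\<^sup>2"
    unfolding cmod_power2 by (simp add: power2_eq_square algebra_simps)
  also have "\<dots> \<le> (r * norm t)\<^sup>2 \<longleftrightarrow> k * k \<le> k * ((norm t)\<^sup>2 + 2 * Re (cnj a * t))"
    by (simp add: k_def power2_eq_square algebra_simps)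
  also have "\<dots> \<longleftrightarrow> k \<le> (norm t)\<^sup>2 + 2 * Re (cnj a * t)"
    using k by simp
  also have "\<dots> \<longleftrightarrow> r\<^sup>2 \<le> (norm (a + t))\<^sup>2"
    unfolding k_def cmod_power2 by (simp add: power2_eq_square algebra_simps)
  also have "\<dots> \<longleftrightarrow> r \<le> norm (a + t)"
    using r by (intro power_mono_iff) auto
  finally show ?thesis .
qed

text \<open>The logarithmic derivative, by the product rule. The minus sign comes from writing its
  terms as \<open>1 / (w i - z)\<close>, which are the roots inverted at \<open>z\<close>.\<close>

lemma poly_pderiv_prod_roots:
  fixes w :: "nat \<Rightarrow> complex"
  assumes "\<And>i. i < n \<Longrightarrow> w i \<noteq> z"
  shows "poly (pderiv (\<Prod>i<n. [:- w i, 1:])) z =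
    - (\<Sum>i<n. 1 / (w i - z)) * poly (\<Prod>i<n. [:- w i, 1:]) z"
  using assms
proof (induction n)
  case (Suc n)
  define b where "b = 1 / (w n - z)"
  define a where "a = (\<Sum>i<n. 1 / (w i - z))"
  define P where "P = poly (\<Prod>i<n. [:- w i, 1:]) z"
  have "w n \<noteq> z" using Suc.prems by simp
  then have "b * (w n - z) = 1" by (simp add: b_def)
  then have "P + (z - w n) * (- a * P) = - (a + b) * (P * (z - w n))" by algebra
  moreover have "poly (pderiv (\<Prod>i<n. [:- w i, 1:])) z = - a * P"
    using Suc by (simp add: a_def P_def)
  moreover have "pderiv (\<Prod>i<Suc n. [:- w i, 1:]) =
      (\<Prod>i<n. [:- w i, 1:]) + [:- w n, 1:] * pderiv (\<Prod>i<n. [:- w i, 1:])"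
    unfolding prod.lessThan_Suc pderiv_mult by (simp add: pderiv_pCons)
  then have "poly (pderiv (\<Prod>i<Suc n. [:- w i, 1:])) z =
      P + (z - w n) * poly (pderiv (\<Prod>i<n. [:- w i, 1:])) z"
    unfolding P_def by (simp only: poly_add poly_mult poly_pCons poly_0) simp
  ultimately have "poly (pderiv (\<Prod>i<Suc n. [:- w i, 1:])) z = - (a + b) * (P * (z - w n))"
    by metis
  also have "P * (z - w n) = poly (\<Prod>i<Suc n. [:- w i, 1:]) z"
    unfolding prod.lessThan_Suc poly_mult P_def by simp
  finally show ?case by (simp only: a_def b_def sum.lessThan_Suc)
qed simp

text \<open>Inversion at \<open>z\<close> maps the complement of the ball into a disc containing 0, so the mean of
  the points \<open>1 / (w - z)\<close>, over the roots \<open>w\<close> together with roots at infinity, stays in that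
  disc, which does not contain \<open>1 / (\<zeta> - z)\<close>.\<close>

lemma laguerre_ball:
  fixes p :: "complex poly"
  assumes p: "\<And>z. z \<in> ball c r \<Longrightarrow> poly p z \<noteq> 0"
    and d: "degree p \<le> d" "d > 0"
    and z: "z \<in> ball c r" and \<zeta>: "\<zeta> \<in> ball c r"
  shows "of_nat d * poly p z + (\<zeta> - z) * poly (pderiv p) z \<noteq> 0"
proof
  assume eq: "of_nat d * poly p z + (\<zeta> - z) * poly (pderiv p) z = 0"
  define n where "n = degree p"
  obtain w where w: "smult (lead_coeff p) (\<Prod>i<n. [:- w i, 1:]) = p"
    unfolding n_def by (rule complex_poly_decompose')
  have pz: "poly p z \<noteq> 0" using p z by blast
  have "poly p (w i) = 0" if "i < n" for i
    using that by (subst w[symmetric]) (auto simp: poly_prod)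
  then have out: "w i \<notin> ball c r" if "i < n" for i
    using p that by blast
  then have wz: "w i \<noteq> z" if "i < n" for i using that z by blast
  have pd: "poly (pderiv p) z = - (\<Sum>i<n. 1 / (w i - z)) * poly p z"
    by (subst (1 2) w[symmetric]) (simp add: pderiv_smult poly_pderiv_prod_roots wz)
  have "(of_nat d - (\<zeta> - z) * (\<Sum>i<n. 1 / (w i - z))) * poly p z = 0"
    using eq unfolding pd by (simp add: algebra_simps)
  \<comment> \<open>A zero of the polar derivative thus makes \<open>1 / (\<zeta> - z)\<close> the
    mean of \<open>d\<close> points: the \<open>n\<close> inverted roots and \<open>d - n\<close>
    zeros.\<close>
  then have sum_eq: "of_nat d = (\<zeta> - z) * (\<Sum>i<n. 1 / (w i - z))" using pz by simp
  then have "\<zeta> - z \<noteq> 0" using d(2) by (metis mult_zero_left of_nat_eq_0_iff less_irrefl)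
  define a where "a = z - c"
  define k where "k = r\<^sup>2 - (norm a)\<^sup>2"
  define q where "q = cnj a / of_real k"
  have a: "norm a < r" using z by (simp add: a_def dist_norm norm_minus_commute)
  have k: "k > 0" using a by (simp add: k_def power_strict_mono)
  note inv = inversion_disc[OF a, folded k_def q_def]
  \<comment> \<open>The value 0 for \<open>i \<ge> n\<close> is the inverse of a root at infinity; 0
    lies in the disc because \<open>norm q = norm a / k\<close> and
    \<open>norm a < r\<close>.\<close>
  define g where "g i = (if i < n then 1 / (w i - z) else 0)" for i
  have g: "norm (g i - q) \<le> r / k" for i
  proof (cases "i < n")
    case True
    have "r \<le> norm (a + (w i - z))"
      using out[OF True] by (simp add: a_def dist_norm norm_minus_commute)
    then show ?thesis using inv[of "w i - z"] wz[OF True] True by (simp add: g_def)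
  next
    case False
    have "norm q = norm a / k" using k by (simp add: q_def norm_divide)
    then show ?thesis using False a k by (simp add: g_def divide_right_mono)
  qed
  have "(\<Sum>i<d. g i) = (\<Sum>i<n. 1 / (w i - z))"
    using d(1) by (intro sum.mono_neutral_cong_right) (auto simp: g_def n_def)
  then have "(\<Sum>i<d. g i) = of_nat d * (1 / (\<zeta> - z))"
    using sum_eq \<open>\<zeta> - z \<noteq> 0\<close> by (simp add: field_simps)
  then have "of_nat d * (1 / (\<zeta> - z) - q) = (\<Sum>i<d. g i - q)"
    by (simp add: sum_subtractf algebra_simps)
  then have "real d * norm (1 / (\<zeta> - z) - q) = norm (\<Sum>i<d. g i - q)"
    by (metis norm_mult norm_of_nat)
  also have "\<dots> \<le> real d * (r / k)"
    using sum_norm_le[of "{..<d}" "\<lambda>i. g i - q" "\<lambda>_. r / k"] g by simp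
  finally have "norm (1 / (\<zeta> - z) - q) \<le> r / k"
    by (rule mult_left_le_imp_le) (use d(2) in simp)
  \<comment> \<open>Inverting back: \<open>a + (\<zeta> - z) = \<zeta> - c\<close>, so
    \<open>\<zeta>\<close> would lie outside the ball.\<close>
  then have "r \<le> norm (a + (\<zeta> - z))" using inv \<open>\<zeta> - z \<noteq> 0\<close> by blast
  then show False using \<zeta> by (simp add: a_def dist_norm norm_minus_commute)
qed

lemma coeff_key_poly: "coeff (key_poly d u) j = of_nat (d choose j) * u j"
  by (auto simp: key_poly_def coeff_sum binomial_eq_0)

lemma key_poly_Suc:
  "key_poly (Suc d) u = key_poly d u + pCons 0 (key_poly d (\<lambda>j. u (Suc j)))"
proof (rule poly_eqI)
  show "coeff (key_poly (Suc d) u) j =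
      coeff (key_poly d u + pCons 0 (key_poly d (\<lambda>j. u (Suc j)))) j" for j
    by (cases j) (simp_all add: coeff_key_poly algebra_simps)
qed

lemma pderiv_key_poly:
  "pderiv (key_poly (Suc d) u) = smult (of_nat (Suc d)) (key_poly d (\<lambda>j. u (Suc j)))"
proof (rule poly_eqI)
  fix j
  have "of_nat (Suc j) * of_nat (Suc d choose Suc j) = (of_nat (Suc d) * of_nat (d choose j) :: complex)"
    unfolding of_nat_mult[symmetric] Suc_times_binomial_eq by (simp add: mult.commute)
  then show "coeff (pderiv (key_poly (Suc d) u)) j =
      coeff (smult (of_nat (Suc d)) (key_poly d (\<lambda>j. u (Suc j)))) j"
    unfolding coeff_pderiv coeff_smult coeff_key_poly mult.assoc[symmetric] by simp
qed

lemma key_poly_add_smult: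
  "key_poly d (\<lambda>j. u j + c * v j) = key_poly d u + smult c (key_poly d v)"
  by (rule poly_eqI) (simp add: coeff_key_poly algebra_simps)

lemma key_poly_cong: "(\<And>j. j \<le> d \<Longrightarrow> u j = v j) \<Longrightarrow> key_poly d u = key_poly d v"
  by (simp add: key_poly_def)

lemma degree_key_poly_le: "degree (key_poly d u) \<le> d"
  by (rule degree_le) (simp add: coeff_key_poly)

lemma sum_Pow_insert:
  assumes "finite A" "a \<notin> A"
  shows "(\<Sum>T\<in>Pow (insert a A). f T) = (\<Sum>T\<in>Pow A. f T) + (\<Sum>T\<in>Pow A. f (insert a T))"
proof -
  have "inj_on (insert a) (Pow A)" using assms(2) by (auto simp: inj_on_def insert_ident)
  then show ?thesis
    unfolding Pow_insert using assms
    by (subst sum.union_disjoint) (auto simp: sum.reindex)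
qed

text \<open>The sum is the polarization of the key polynomial: if all \<open>y s\<close> equal
  \<open>z\<close>, the \<open>d choose j\<close> subsets of size \<open>j\<close> give back its
  terms. Fixing one variable \<open>y s\<close> leaves the polarization, in the remaining variables,
  of the polar derivative, which has no zero in the ball by Laguerre. Hence induction on
  \<open>S\<close> for arbitrary \<open>u\<close>.\<close>

lemma grace_walsh_szego_ball:
  fixes u :: "nat \<Rightarrow> complex" and y :: "'a \<Rightarrow> complex"
  assumes "finite S" "r > 0" "\<And>z. z \<in> ball c r \<Longrightarrow> poly (key_poly (card S) u) z \<noteq> 0"
    and "\<And>s. s \<in> S \<Longrightarrow> y s \<in> ball c r"
  shows "(\<Sum>T\<in>Pow S. u (card T) * (\<Prod>s\<in>T. y s)) \<noteq> 0"
  using assms(1,3,4)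
proof (induction S arbitrary: u rule: finite_induct)
  case empty
  then have "poly (key_poly 0 u) c \<noteq> 0" using \<open>r > 0\<close> by simp
  then show ?case by (simp add: key_poly_def poly_monom)
next
  case (insert s S)
  define d where "d = card S"
  let ?v = "\<lambda>j. u j + y s * u (Suc j)"
  have fin: "finite T" if "T \<in> Pow S" for T using that insert.hyps(1) finite_subset by blast
  have nonzero: "poly (key_poly (card S) ?v) z \<noteq> 0" if z: "z \<in> ball c r" for z
  proof -
    \<comment> \<open>By Pascal's rule and the shift of activities under differentiation, the polar
      derivative of \<open>?p\<close> with pole \<open>y s\<close> is, up to the factor
      \<open>Suc d\<close>, the key polynomial with activities \<open>?v\<close>.\<close>
    let ?p = "key_poly (Suc d) u"
    have "of_nat (Suc d) * poly (key_poly d ?v) z =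
        of_nat (Suc d) * poly ?p z + (y s - z) * poly (pderiv ?p) z"
      unfolding pderiv_key_poly unfolding key_poly_add_smult key_poly_Suc
      by (simp add: algebra_simps del: of_nat_Suc)
    also have "\<dots> \<noteq> 0"
      using insert.prems insert.hyps z
      by (intro laguerre_ball[of c r]) (auto simp: degree_key_poly_le d_def)
    finally show ?thesis by (auto simp: d_def)
  qed
  have "(\<Sum>T\<in>Pow (insert s S). u (card T) * (\<Prod>s\<in>T. y s)) =
      (\<Sum>T\<in>Pow S. ?v (card T) * (\<Prod>s\<in>T. y s))"
    unfolding sum_Pow_insert[OF insert.hyps] sum.distrib[symmetric]
  proof (intro sum.cong refl)
    fix T assume T: "T \<in> Pow S"
    then have "s \<notin> T" using insert.hyps(2) by blast
    then show "u (card T) * prod y T + u (card (insert s T)) * prod y (insert s T) =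
        ?v (card T) * prod y T"
      using fin[OF T] by (simp add: algebra_simps)
  qed
  also have "\<dots> \<noteq> 0" using insert.IH[of ?v] nonzero insert.prems(2) by blast
  finally show ?case .
qed

section \<open>Subset sums over disjoint unions\<close>

lemma sum_Pow_Un:
  assumes "finite A" "finite B" "A \<inter> B = {}"
  shows "(\<Sum>T\<in>Pow (A \<union> B). f T) = (\<Sum>S\<in>Pow A. \<Sum>T\<in>Pow B. f (S \<union> T))"
proof -
  have "(\<Sum>S\<in>Pow A. \<Sum>T\<in>Pow B. f (S \<union> T)) = (\<Sum>(S, T)\<in>Pow A \<times> Pow B. f (S \<union> T))"
    by (simp add: sum.cartesian_product)
  also have "\<dots> = (\<Sum>T\<in>Pow (A \<union> B). f T)"
    by (rule sum.reindex_bij_witness[of _ "\<lambda>T. (T \<inter> A, T \<inter> B)" "\<lambda>(S, T). S \<union> T"])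
      (use assms(3) in auto)
  finally show ?thesis ..
qed

text \<open>Choosing one subset of each \<open>S v\<close> amounts to choosing one subset of their
  disjoint union. This expands the product of the vertex polarizations into a single sum over sets
  of half-edges.\<close>

lemma prod_sum_Pow_disjoint:
  fixes f :: "'v \<Rightarrow> 'a set \<Rightarrow> 'b :: comm_semiring_1"
  assumes "finite V" "\<And>v. v \<in> V \<Longrightarrow> finite (S v)" "disjoint_family_on S V"
  shows "(\<Prod>v\<in>V. \<Sum>T\<in>Pow (S v). f v T) = (\<Sum>T\<in>Pow (\<Union>v\<in>V. S v). \<Prod>v\<in>V. f v (T \<inter> S v))"
  using assms
proof (induction V rule: finite_induct)
  case (insert w V)
  let ?U = "\<Union>v\<in>V. S v"
  have disj: "S w \<inter> S v = {}" if "v \<in> V" for v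
    using insert.prems(2) insert.hyps(2) that by (auto simp: disjoint_family_on_def)
  have "disjoint_family_on S V"
    using insert.prems(2) by (rule disjoint_family_on_mono[rotated]) auto
  then have IH: "(\<Prod>v\<in>V. \<Sum>T\<in>Pow (S v). f v T) = (\<Sum>T\<in>Pow ?U. \<Prod>v\<in>V. f v (T \<inter> S v))"
    using insert by simp
  have "(\<Sum>T\<in>Pow (\<Union>v\<in>insert w V. S v). \<Prod>v\<in>insert w V. f v (T \<inter> S v)) =
      (\<Sum>R\<in>Pow (S w). \<Sum>T\<in>Pow ?U. \<Prod>v\<in>insert w V. f v ((R \<union> T) \<inter> S v))"
    using insert.hyps insert.prems disj unfolding UN_insert
    by (subst sum_Pow_Un) auto
  also have "\<dots> = (\<Sum>R\<in>Pow (S w). \<Sum>T\<in>Pow ?U. f w R * (\<Prod>v\<in>V. f v (T \<inter> S v)))"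
  proof (intro sum.cong refl)
    fix R T assume R: "R \<in> Pow (S w)" and T: "T \<in> Pow ?U"
    have "(R \<union> T) \<inter> S w = R" using R T disj by fast
    moreover have "(R \<union> T) \<inter> S v = T \<inter> S v" if "v \<in> V" for v using R disj[OF that] by blast
    ultimately show "(\<Prod>v\<in>insert w V. f v ((R \<union> T) \<inter> S v)) = f w R * (\<Prod>v\<in>V. f v (T \<inter> S v))"
      using insert.hyps by simp
  qed
  also have "\<dots> = (\<Prod>v\<in>insert w V. \<Sum>T\<in>Pow (S v). f v T)"
    using insert.hyps by (simp add: IH sum_product)
  finally show ?case ..
qed simp

section \<open>Asano contraction of edges\<close>

text \<open>The quadratic is \<open>a + b y + c y' + d y y'\<close> on the diagonal \<open>y = y'\<close>, with \<open>s = b + c\<close>;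
  the diagonal already suffices for the contraction.\<close>

definition contractive :: "complex set \<Rightarrow> complex \<Rightarrow> bool" where
  "contractive C l \<longleftrightarrow>
     (\<forall>a s d. (\<forall>y\<in>C. a + s * y + d * y\<^sup>2 \<noteq> 0) \<longrightarrow> a + l * d \<noteq> 0)"

text \<open>The quadratic formula, with the roots counted with multiplicity, so that Vieta's formula
  for their product holds even when \<open>r = t\<close>.\<close>

lemma quadratic_roots:
  fixes a s d :: complex
  assumes "d \<noteq> 0"
  obtains r t where "a = d * (r * t)" "a + s * r + d * r\<^sup>2 = 0" "a + s * t + d * t\<^sup>2 = 0"
proof -
  define D where "D = csqrt (s\<^sup>2 - 4 * a * d)"
  have D: "D * D = s * s - 4 * a * d" by (simp add: D_def flip: power2_eq_square)
  define r where "r = (- s + D) / (2 * d)"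
  define t where "t = (- s - D) / (2 * d)"
  have r: "2 * d * r = - s + D" and t: "2 * d * t = - s - D"
    using assms by (simp_all add: r_def t_def)
  have rt: "s = - d * (r + t)" using r t by algebra
  have "4 * d * a = 4 * d * (d * (r * t))" using D r t by algebra
  then have a: "a = d * (r * t)" using assms by simp
  show thesis
    by (rule that[OF a]) (simp_all add: a rt algebra_simps power2_eq_square)
qed

text \<open>Both roots lie outside the disc, so their product \<open>a / d\<close> has modulus above
  R^2 and cannot equal \<open>- l\<close>.\<close>

lemma contractive_cball:
  assumes "norm l \<le> R\<^sup>2" "R \<ge> 0"
  shows "contractive (cball 0 R) l"
  unfolding contractive_def
proof (intro allI impI notI)
  fix a s d assume nz: "\<forall>y\<in>cball 0 R. a + s * y + d * y\<^sup>2 \<noteq> 0" and eq: "a + l * d = 0"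
  have "a \<noteq> 0" using nz[rule_format, of 0] assms(2) by simp
  then have "d \<noteq> 0" using eq by auto
  then obtain r t where "a = d * (r * t)" "a + s * r + d * r\<^sup>2 = 0" "a + s * t + d * t\<^sup>2 = 0"
    by (rule quadratic_roots)
  then have big: "norm r > R" "norm t > R" using nz by (force simp: not_le)+
  have "d * (r * t + l) = 0" using eq \<open>a = d * (r * t)\<close> by algebra
  then have "r * t = - l" using \<open>d \<noteq> 0\<close> by (simp add: eq_neg_iff_add_eq_0)
  then have "norm l = norm r * norm t" by (metis norm_minus_cancel norm_mult)
  moreover have "R * R < norm r * norm t" using big assms(2) by (intro mult_strict_mono) auto
  ultimately show False using assms(1) by (simp add: power2_eq_square)
qed

text \<open>Two numbers with negative real part cannot have product \<open>- x\<close> with x \<ge>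
  0: then t = - x * cnj r / |r|^2, whose real part is nonnegative.\<close>

lemma contractive_halfplane:
  assumes "l \<in> \<real>\<^sub>\<ge>\<^sub>0"
  shows "contractive {y. Re y \<ge> 0} l"
  unfolding contractive_def
proof (intro allI impI notI)
  fix a s d assume nz: "\<forall>y\<in>{y. Re y \<ge> 0}. a + s * y + d * y\<^sup>2 \<noteq> 0" and eq: "a + l * d = 0"
  obtain x where x: "l = of_real x" "x \<ge> 0" using assms by (rule nonneg_Reals_cases)
  have "a \<noteq> 0" using nz[rule_format, of 0] by simp
  then have "d \<noteq> 0" using eq by auto
  then obtain r t where "a = d * (r * t)" "a + s * r + d * r\<^sup>2 = 0" "a + s * t + d * t\<^sup>2 = 0"
    by (rule quadratic_roots)
  then have neg: "Re r < 0" "Re t < 0" using nz by (force simp: not_le)+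
  have "d * (r * t + l) = 0" using eq \<open>a = d * (r * t)\<close> by algebra
  then have "r * t = - l" using \<open>d \<noteq> 0\<close> by (simp add: eq_neg_iff_add_eq_0)
  then have "(cnj r * r) * t = - (cnj r * of_real x)" using x by (simp add: mult.assoc)
  then have "of_real ((norm r)\<^sup>2) * t = - (cnj r * of_real x)"
    by (metis complex_norm_square mult.commute)
  from arg_cong[OF this, of Re] have "(norm r)\<^sup>2 * Re t = - (Re r * x)"
    by (simp del: of_real_power)
  moreover have "- (Re r * x) \<ge> 0" using neg x by (simp add: mult_nonpos_nonneg)
  moreover have "(norm r)\<^sup>2 * Re t < 0" using neg by (intro mult_pos_neg) auto
  ultimately show False by linarith
qed

text \<open>The half-edges of \<open>e\<close> are \<open>(e, False)\<close> and
  \<open>(e, True)\<close>, and only the coefficients of sets \<open>H \<times> UNIV\<close>,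
  containing both or neither half of every edge, survive. Edges are contracted one at a time while
  the variables of the other half-edges are held fixed in \<open>C\<close>.\<close>

lemma asano_contraction:
  fixes c :: "('e \<times> bool) set \<Rightarrow> complex"
  assumes "finite E" "\<And>e. e \<in> E \<Longrightarrow> contractive C (l e)"
    and "\<And>y. (\<And>h. y h \<in> C) \<Longrightarrow> (\<Sum>T\<in>Pow (E \<times> UNIV). c T * (\<Prod>h\<in>T. y h)) \<noteq> 0"
    and "C \<noteq> {}"
  shows "(\<Sum>H\<in>Pow E. (\<Prod>e\<in>H. l e) * c (H \<times> UNIV)) \<noteq> 0"
  using assms(1-3)
proof (induction E arbitrary: c rule: finite_induct)
  case empty
  obtain y where "y \<in> C" using assms(4) by blast
  then show ?case using empty.prems(2)[of "\<lambda>_. y"] by simp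
next
  case (insert e E)
  let ?h = "(e, False)" and ?h' = "(e, True)"
  have UN: "insert e E \<times> UNIV = insert ?h (insert ?h' (E \<times> (UNIV :: bool set)))"
    by (auto simp: UNIV_bool)
  have fin: "finite (E \<times> (UNIV :: bool set))" using insert.hyps by simp
  have e: "?h' \<notin> E \<times> UNIV" "?h \<notin> insert ?h' (E \<times> UNIV)" using insert.hyps by auto
  \<comment> \<open>Coefficients after contracting \<open>e\<close>: monomials with neither half of
    \<open>e\<close> are kept, those with both get the weight \<open>l e\<close>, those with exactly
    one are dropped.\<close>
  let ?c = "\<lambda>T. c T + l e * c (insert ?h (insert ?h' T))"
  have "(\<Sum>H\<in>Pow E. (\<Prod>e\<in>H. l e) * ?c (H \<times> UNIV)) \<noteq> 0"
  proof (rule insert.IH)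
    fix y :: "'e \<times> bool \<Rightarrow> complex" assume y: "\<And>h. y h \<in> C"
    define S where "S g = (\<Sum>T\<in>Pow (E \<times> UNIV). c (g T) * (\<Prod>h\<in>T. y h))" for g
    have "S id + (S (insert ?h) + S (insert ?h')) * t
        + S (\<lambda>T. insert ?h (insert ?h' T)) * t\<^sup>2 \<noteq> 0" if t: "t \<in> C" for t
    proof -
      \<comment> \<open>Both halves of \<open>e\<close> receive the same value, which produces the
        quadratic in the definition of \<open>contractive\<close>.\<close>
      define y' where "y' = y(?h := t, ?h' := t)"
      have "y' h \<in> C" for h using y t by (simp add: y'_def)
      then have nz: "(\<Sum>T\<in>Pow (insert e E \<times> UNIV). c T * (\<Prod>h\<in>T. y' h)) \<noteq> 0"
        by (rule insert.prems(2))
      have y'h: "y' ?h = t" "y' ?h' = t" by (simp_all add: y'_def)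
      have rest: "finite T \<and> ?h \<notin> T \<and> ?h' \<notin> T \<and> prod y' T = prod y T"
        if "T \<in> Pow (E \<times> UNIV)" for T
      proof -
        have "?h \<notin> T" "?h' \<notin> T" using that insert.hyps by auto
        then have "prod y' T = prod y T" by (intro prod.cong) (auto simp: y'_def)
        then show ?thesis using that fin \<open>?h \<notin> T\<close> \<open>?h' \<notin> T\<close> finite_subset by auto
      qed
      have "(\<Sum>T\<in>Pow (insert e E \<times> UNIV). c T * (\<Prod>h\<in>T. y' h)) =
        (\<Sum>T\<in>Pow (E \<times> UNIV). c T * (\<Prod>h\<in>T. y h)
           + t * (c (insert ?h' T) * (\<Prod>h\<in>T. y h))
           + (t * (c (insert ?h T) * (\<Prod>h\<in>T. y h))
           + t\<^sup>2 * (c (insert ?h (insert ?h' T)) * (\<Prod>h\<in>T. y h))))"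
        unfolding UN sum_Pow_insert[OF fin e(1)] sum_Pow_insert[OF finite.insertI[OF fin] e(2)]
          sum.distrib[symmetric]
        by (intro sum.cong refl) (use rest in \<open>simp add: y'h power2_eq_square\<close>)
      also have "\<dots> = S id + (S (insert ?h) + S (insert ?h')) * t
        + S (\<lambda>T. insert ?h (insert ?h' T)) * t\<^sup>2"
        by (simp add: S_def sum.distrib sum_distrib_left algebra_simps)
      finally show ?thesis using nz by simp
    qed
    then have "S id + l e * S (\<lambda>T. insert ?h (insert ?h' T)) \<noteq> 0"
      using insert.prems(1)[of e] unfolding contractive_def by blast
    then show "(\<Sum>T\<in>Pow (E \<times> UNIV). ?c T * (\<Prod>h\<in>T. y h)) \<noteq> 0"
      by (simp add: S_def sum.distrib sum_distrib_left algebra_simps)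
  qed (use insert.prems in auto)
  also have "(\<Sum>H\<in>Pow E. (\<Prod>e\<in>H. l e) * ?c (H \<times> UNIV)) =
      (\<Sum>H\<in>Pow (insert e E). (\<Prod>e\<in>H. l e) * c (H \<times> UNIV))"
    unfolding sum_Pow_insert[OF insert.hyps] sum.distrib[symmetric]
  proof (intro sum.cong refl)
    fix H assume H: "H \<in> Pow E"
    have "insert ?h (insert ?h' (H \<times> UNIV)) = insert e H \<times> UNIV" by (auto simp: UNIV_bool)
    moreover have "finite H" "e \<notin> H" using H insert.hyps finite_subset by auto
    ultimately show "prod l H * ?c (H \<times> UNIV) =
        prod l H * c (H \<times> UNIV) + prod l (insert e H) * c (insert e H \<times> UNIV)"
      by (simp add: algebra_simps)
  qed
  finally show ?case .
qed

section \<open>Half-edges and the nonvanishing criterion for \<open>Z\<close>\<close>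

text \<open>Here \<open>t h\<close> is the vertex carrying the half-edge \<open>h\<close>, for an
  arbitrary ordering of the endpoints. Both halves of a loop sit at the same vertex, so counting
  half-edges counts a loop twice.\<close>

lemma multigraph_half_edges:
  assumes "finite_multigraph V E ends"
  obtains t where "\<And>e. e \<in> E \<Longrightarrow> ends e = {#t (e, False), t (e, True)#}"
proof -
  have "\<exists>p. ends e = {#fst p, snd p#}" if "e \<in> E" for e
  proof -
    have "size (ends e) = Suc (Suc 0)"
      using finite_multigraph.size_ends[OF assms that] by simp
    moreover from this obtain a M where M: "ends e = add_mset a M"
      using size_eq_Suc_imp_eq_union by blast
    ultimately have "size M = 1" by simp
    then obtain b where "M = {#b#}" using size_1_singleton_mset by blast
    then have "ends e = {#fst (a, b), snd (a, b)#}" using M by simp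
    then show ?thesis ..
  qed
  then obtain p where "\<And>e. e \<in> E \<Longrightarrow> ends e = {#fst (p e), snd (p e)#}" by metis
  then show thesis by (intro that[of "\<lambda>h. if snd h then snd (p (fst h)) else fst (p (fst h))"]) simp
qed

lemma deg_eq_card:
  assumes "finite H" "\<And>e. e \<in> H \<Longrightarrow> ends e = {#t (e, False), t (e, True)#}"
  shows "deg ends H v = card {h \<in> H \<times> UNIV. t h = v}"
proof -
  have "deg ends H v = (\<Sum>e\<in>H. \<Sum>b\<in>UNIV. if t (e, b) = v then 1 else 0)"
    unfolding deg_def using assms(2) by (intro sum.cong refl) (simp add: UNIV_bool)
  also have "\<dots> = (\<Sum>h\<in>H \<times> UNIV. if t h = v then 1 else 0)"
    by (simp add: sum.cartesian_product split_def)
  also have "\<dots> = card {h \<in> H \<times> UNIV. t h = v}"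
    using assms(1) by (simp add: sum.inter_filter[symmetric])
  finally show ?thesis .
qed

text \<open>Polarization at the vertices followed by contraction along the edges. The ball in the
  last premise may depend on the finite set \<open>Y\<close>, because a half-plane fits into no
  ball, whereas only finitely many values \<open>x v * y h\<close> occur at a vertex.\<close>

lemma Z_nonzero:
  fixes lam :: "'e \<Rightarrow> complex" and x :: "'v \<Rightarrow> complex"
  assumes G: "finite_multigraph V E ends"
    and lam: "\<And>e. e \<in> E \<Longrightarrow> contractive C (lam e)" and "C \<noteq> {}"
    and K: "\<And>v Y. v \<in> V \<Longrightarrow> finite Y \<Longrightarrow> Y \<subseteq> C \<Longrightarrow>
      \<exists>c r. r > 0 \<and> (\<forall>y\<in>Y. x v * y \<in> ball c r) \<and>
        (\<forall>z\<in>ball c r. poly (key_poly (deg ends E v) (u v)) z \<noteq> 0)"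
  shows "Z V E ends lam u x \<noteq> 0"
proof -
  interpret finite_multigraph V E ends by fact
  obtain t where t: "\<And>e. e \<in> E \<Longrightarrow> ends e = {#t (e, False), t (e, True)#}"
    using multigraph_half_edges[OF G] by blast
  have tV: "t h \<in> V" if "h \<in> E \<times> UNIV" for h
  proof -
    obtain e b where h: "h = (e, b)" "e \<in> E" using \<open>h \<in> _\<close> by auto
    then have "t h \<in> set_mset (ends e)" using t[of e] by (cases b) auto
    then show ?thesis using ends_in_V h(2) by blast
  qed
  define S where "S v = {h \<in> E \<times> (UNIV :: bool set). t h = v}" for v
  have finS: "finite (S v)" for v using finite_E by (simp add: S_def)
  have degE: "deg ends E v = card (S v)" for v
    unfolding S_def by (rule deg_eq_card) (use finite_E t in auto)
  \<comment> \<open>The coefficient of the monomial of \<open>T\<close> in the product of all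
    polarizations, with the powers of \<open>x v\<close> absorbed. For
    \<open>T = H \<times> UNIV\<close> the cardinalities become the degrees in
    \<open>H\<close>.\<close>
  define c where "c T = (\<Prod>v\<in>V. u v (card (T \<inter> S v)) * x v ^ card (T \<inter> S v))" for T
  have "(\<Sum>H\<in>Pow E. (\<Prod>e\<in>H. lam e) * c (H \<times> UNIV)) \<noteq> 0"
  proof (rule asano_contraction[OF finite_E lam _ \<open>C \<noteq> {}\<close>])
    fix y :: "'e \<times> bool \<Rightarrow> complex" assume y: "\<And>h. y h \<in> C"
    have "(\<Sum>T\<in>Pow (S v). u v (card T) * (\<Prod>h\<in>T. x v * y h)) \<noteq> 0" if v: "v \<in> V" for v
    proof -
      obtain c r where "r > 0" "\<forall>y'\<in>y ` S v. x v * y' \<in> ball c r"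
        "\<forall>z\<in>ball c r. poly (key_poly (deg ends E v) (u v)) z \<noteq> 0"
        using K[OF v, of "y ` S v"] finS y by blast
      then show ?thesis
        by (intro grace_walsh_szego_ball[of _ r c]) (auto simp: finS degE simp del: mem_ball)
    qed
    then have "(\<Prod>v\<in>V. \<Sum>T\<in>Pow (S v). u v (card T) * (\<Prod>h\<in>T. x v * y h)) \<noteq> 0"
      using finite_V by simp
    also have "(\<Prod>v\<in>V. \<Sum>T\<in>Pow (S v). u v (card T) * (\<Prod>h\<in>T. x v * y h)) =
        (\<Sum>T\<in>Pow (\<Union>v\<in>V. S v). \<Prod>v\<in>V. u v (card (T \<inter> S v)) * (\<Prod>h\<in>T \<inter> S v. x v * y h))"
      by (rule prod_sum_Pow_disjoint) (use finite_V finS in \<open>auto simp: disjoint_family_on_def S_def\<close>)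
    also have "(\<Union>v\<in>V. S v) = E \<times> UNIV" using tV by (auto simp: S_def)
    also have "(\<Sum>T\<in>Pow (E \<times> UNIV). \<Prod>v\<in>V. u v (card (T \<inter> S v)) * (\<Prod>h\<in>T \<inter> S v. x v * y h)) =
        (\<Sum>T\<in>Pow (E \<times> UNIV). c T * (\<Prod>h\<in>T. y h))"
    proof (intro sum.cong refl)
      fix T assume T: "T \<in> Pow (E \<times> (UNIV :: bool set))"
      then have "finite T" using finite_E by (auto intro: finite_subset)
      have "(\<Prod>h\<in>T. y h) = (\<Prod>v\<in>V. \<Prod>h\<in>{h \<in> T. t h = v}. y h)"
        using \<open>finite T\<close> finite_V T tV by (intro prod.group[symmetric]) auto
      also have "\<dots> = (\<Prod>v\<in>V. \<Prod>h\<in>T \<inter> S v. y h)"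
        using T by (intro prod.cong refl) (auto simp: S_def)
      finally show "(\<Prod>v\<in>V. u v (card (T \<inter> S v)) * (\<Prod>h\<in>T \<inter> S v. x v * y h)) = c T * (\<Prod>h\<in>T. y h)"
        by (simp add: c_def prod.distrib mult_ac)
    qed
    finally show "(\<Sum>T\<in>Pow (E \<times> UNIV). c T * (\<Prod>h\<in>T. y h)) \<noteq> 0" .
  qed
  also have "(\<Sum>H\<in>Pow E. (\<Prod>e\<in>H. lam e) * c (H \<times> UNIV)) = Z V E ends lam u x"
    unfolding Z_def
  proof (intro sum.cong refl)
    fix H assume H: "H \<in> Pow E"
    then have "deg ends H v = card {h \<in> H \<times> UNIV. t h = v}" for v
      using finite_E finite_subset t by (intro deg_eq_card) auto
    moreover have "{h \<in> H \<times> UNIV. t h = v} = (H \<times> UNIV) \<inter> S v" for v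
      using H by (auto simp: S_def)
    ultimately show "(\<Prod>e\<in>H. lam e) * c (H \<times> UNIV) =
        (\<Prod>e\<in>H. lam e) * (\<Prod>v\<in>V. u v (deg ends H v)) * (\<Prod>v\<in>V. x v ^ deg ends H v)"
      by (simp add: c_def prod.distrib)
  qed
  finally show ?thesis .
qed

section \<open>Identically vanishing key polynomials\<close>

lemma deg_mono: "finite E \<Longrightarrow> H \<subseteq> E \<Longrightarrow> deg ends H v \<le> deg ends E v"
  unfolding deg_def by (rule sum_mono2) auto

text \<open>Binomial coefficients \<open>d choose j\<close> with \<open>j \<le> d\<close> are
  nonzero in the complex numbers, so all activities at \<open>v\<close> up to the degree vanish, and
  every term of \<open>Z\<close> contains one of them.\<close>

lemma Z_eq_0_if_key_poly_eq_0:
  assumes "finite_multigraph V E ends" "v \<in> V" "key_poly (deg ends E v) (u v) = 0"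
  shows "Z V E ends lam u x = 0"
proof -
  interpret finite_multigraph V E ends by fact
  have "u v j = 0" if "j \<le> deg ends E v" for j
    using arg_cong[OF assms(3), of "\<lambda>p. coeff p j"] that by (simp add: coeff_key_poly)
  then have "(\<Prod>v\<in>V. u v (deg ends H v)) = 0" if "H \<in> Pow E" for H
    using that assms(2) finite_V deg_mono[OF finite_E, of H ends] by (intro prod_zero bexI[of _ v]) auto
  then show ?thesis by (simp add: Z_def)
qed

lemma poly_nonvanishing_iff:
  "poly_nonvanishing A p \<longleftrightarrow> p = 0 \<or> (\<forall>z\<in>A. poly p z \<noteq> 0)"
proof -
  have "(\<forall>z :: unit \<Rightarrow> complex. poly p (z ()) = 0) \<longleftrightarrow> p = 0"
  proof
    assume "\<forall>z :: unit \<Rightarrow> complex. poly p (z ()) = 0"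
    then have "poly p x = 0" for x by (drule_tac x = "\<lambda>_. x" in spec)
    then show "p = 0" using poly_all_0_iff_0 by blast
  qed simp
  moreover have "(\<forall>z :: unit \<Rightarrow> complex. z () \<in> A \<longrightarrow> poly p (z ()) \<noteq> 0) \<longleftrightarrow> (\<forall>z\<in>A. poly p z \<noteq> 0)"
  proof
    assume *: "\<forall>z :: unit \<Rightarrow> complex. z () \<in> A \<longrightarrow> poly p (z ()) \<noteq> 0"
    show "\<forall>z\<in>A. poly p z \<noteq> 0"
    proof
      show "poly p z \<noteq> 0" if "z \<in> A" for z using *[rule_format, of "\<lambda>_. z"] that .
    qed
  qed simp
  ultimately show ?thesis by (simp only: poly_nonvanishing_def nonvanishing_def ball_simps simp_thms)
qed

text \<open>Disposes of the alternative that a key polynomial is zero: then \<open>Z\<close> is zero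
  as well, which counts as nonvanishing.\<close>

lemma nonvanishing_if_all_key_poly_nonzero:
  assumes "finite_multigraph V E ends"
    and "(\<And>v. v \<in> V \<Longrightarrow> key_poly (deg ends E v) (u v) \<noteq> 0) \<Longrightarrow>
      nonvanishing A V (Z V E ends lam u)"
  shows "nonvanishing A V (Z V E ends lam u)"
  using assms Z_eq_0_if_key_poly_eq_0[OF assms(1)] unfolding nonvanishing_def by blast

section \<open>Discs, part (b)\<close>

text \<open>The radius \<open>sqrt lmax\<close> is large enough to contract every edge, and
  multiplication by \<open>x v\<close> maps the disc of that radius into
  \<open>ball 0 \<kappa>\<close>, which therefore serves for every \<open>Y\<close>.\<close>

lemma Z_nonzero_disc:
  assumes G: "finite_multigraph V E ends" and "\<kappa> > 0" "lmax > 0"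
    and lam: "\<And>e. e \<in> E \<Longrightarrow> norm (lam e) \<le> lmax"
    and K: "\<And>v z. v \<in> V \<Longrightarrow> z \<in> disc \<kappa> \<Longrightarrow> poly (key_poly (deg ends E v) (u v)) z \<noteq> 0"
    and x: "\<And>v. v \<in> V \<Longrightarrow> x v \<in> disc (\<kappa> / sqrt lmax)"
  shows "Z V E ends lam u x \<noteq> 0"
proof (rule Z_nonzero[OF G])
  show "contractive (cball 0 (sqrt lmax)) (lam e)" if "e \<in> E" for e
    using lam[OF that] \<open>lmax > 0\<close> by (intro contractive_cball) auto
  show "cball 0 (sqrt lmax) \<noteq> ({} :: complex set)" using \<open>lmax > 0\<close> by simp
  fix v Y assume v: "v \<in> V" and "Y \<subseteq> cball (0 :: complex) (sqrt lmax)"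
  have "x v * y \<in> ball 0 \<kappa>" if "y \<in> Y" for y
  proof -
    have "norm y \<le> sqrt lmax" using that \<open>Y \<subseteq> _\<close> by auto
    then have "norm (x v) * norm y \<le> norm (x v) * sqrt lmax" by (intro mult_left_mono) auto
    also have "\<dots> < \<kappa>" using x[OF v] \<open>lmax > 0\<close> by (simp add: disc_def field_simps)
    finally show ?thesis by (simp add: norm_mult)
  qed
  moreover have "poly (key_poly (deg ends E v) (u v)) z \<noteq> 0" if "z \<in> ball 0 \<kappa>" for z
    using that by (intro K v) (simp add: disc_def)
  ultimately show "\<exists>c r. r > 0 \<and> (\<forall>y\<in>Y. x v * y \<in> ball c r) \<and>
      (\<forall>z\<in>ball c r. poly (key_poly (deg ends E v) (u v)) z \<noteq> 0)"
    using \<open>\<kappa> > 0\<close> by blast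
qed

section \<open>Exteriors, part (c), through complementary subgraphs\<close>

lemma poly_key_poly: "poly (key_poly d u) z = (\<Sum>j\<le>d. of_nat (d choose j) * u j * z ^ j)"
  by (simp add: key_poly_def poly_sum poly_monom)

lemma poly_key_poly_rev:
  assumes "z \<noteq> 0"
  shows "poly (key_poly d (\<lambda>j. u (d - j))) z = z ^ d * poly (key_poly d u) (1 / z)"
proof -
  have "poly (key_poly d (\<lambda>j. u (d - j))) z = (\<Sum>j\<le>d. of_nat (d choose (d - j)) * u (d - j) * z ^ j)"
    unfolding poly_key_poly by (intro sum.cong refl) (simp add: binomial_symmetric[symmetric])
  also have "\<dots> = (\<Sum>j\<le>d. of_nat (d choose j) * u j * z ^ (d - j))"
    by (rule sum.reindex_bij_witness[of _ "\<lambda>j. d - j" "\<lambda>j. d - j"]) auto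
  also have "\<dots> = z ^ d * poly (key_poly d u) (1 / z)"
    unfolding poly_key_poly sum_distrib_left using assms
    by (intro sum.cong refl) (simp add: power_diff power_divide)
  finally show ?thesis .
qed

lemma deg_Diff:
  assumes "finite E" "H \<subseteq> E"
  shows "deg ends (E - H) v = deg ends E v - deg ends H v"
  unfolding deg_def using sum_diff_nat[of H E] assms finite_subset by metis

text \<open>Substituting \<open>E - H\<close> for \<open>H\<close> turns degrees into codegrees;
  extracting the full products inverts the weights and the variables and reverses the
  activities.\<close>

lemma Z_complement:
  assumes G: "finite_multigraph V E ends" and lam: "\<And>e. e \<in> E \<Longrightarrow> lam e \<noteq> 0"
    and x: "\<And>v. v \<in> V \<Longrightarrow> x v \<noteq> 0"
  shows "Z V E ends lam u x = (\<Prod>e\<in>E. lam e) * (\<Prod>v\<in>V. x v ^ deg ends E v) *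
    Z V E ends (\<lambda>e. 1 / lam e) (\<lambda>v j. u v (deg ends E v - j)) (\<lambda>v. 1 / x v)"
proof -
  interpret finite_multigraph V E ends by fact
  let ?D = "deg ends E"
  have "Z V E ends lam u x = (\<Sum>H\<in>Pow E. (\<Prod>e\<in>E - H. lam e) *
      (\<Prod>v\<in>V. u v (deg ends (E - H) v)) * (\<Prod>v\<in>V. x v ^ deg ends (E - H) v))"
    unfolding Z_def by (rule sum.reindex_bij_witness[of _ "\<lambda>H. E - H" "\<lambda>H. E - H"]) (auto simp: double_diff)
  also have "\<dots> = (\<Sum>H\<in>Pow E. ((\<Prod>e\<in>E. lam e) * (\<Prod>e\<in>H. 1 / lam e)) *
      (\<Prod>v\<in>V. u v (?D v - deg ends H v)) *
      ((\<Prod>v\<in>V. x v ^ ?D v) * (\<Prod>v\<in>V. (1 / x v) ^ deg ends H v)))"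
  proof (intro sum.cong refl arg_cong2[where f = "(*)"])
    fix H assume "H \<in> Pow E"
    then have H: "H \<subseteq> E" by blast
    have "finite H" using H finite_E finite_subset by blast
    have "(\<Prod>e\<in>E. lam e) = (\<Prod>e\<in>E - H. lam e) * (\<Prod>e\<in>H. lam e)"
      by (rule prod.subset_diff[OF H finite_E])
    moreover have "(\<Prod>e\<in>H. lam e) \<noteq> 0" using lam H \<open>finite H\<close> by auto
    ultimately show "(\<Prod>e\<in>E - H. lam e) = (\<Prod>e\<in>E. lam e) * (\<Prod>e\<in>H. 1 / lam e)"
      by (simp add: prod_dividef)
    show "(\<Prod>v\<in>V. u v (deg ends (E - H) v)) = (\<Prod>v\<in>V. u v (?D v - deg ends H v))"
      by (simp add: deg_Diff[OF finite_E H])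
    show "(\<Prod>v\<in>V. x v ^ deg ends (E - H) v) =
        (\<Prod>v\<in>V. x v ^ ?D v) * (\<Prod>v\<in>V. (1 / x v) ^ deg ends H v)"
      unfolding prod.distrib[symmetric] using x deg_mono[OF finite_E H, of ends]
      by (intro prod.cong refl) (simp add: deg_Diff[OF finite_E H] power_diff power_divide)
  qed
  also have "\<dots> = (\<Prod>e\<in>E. lam e) * (\<Prod>v\<in>V. x v ^ ?D v) *
    Z V E ends (\<lambda>e. 1 / lam e) (\<lambda>v j. u v (?D v - j)) (\<lambda>v. 1 / x v)"
    unfolding Z_def sum_distrib_left by (intro sum.cong refl) (simp only: mult_ac)
  finally show ?thesis .
qed

text \<open>The disc case for the complementary sum, with \<open>1 / \<kappa>\<close> and
  \<open>1 / lmin\<close> in place of \<open>\<kappa>\<close> and \<open>lmax\<close>.\<close>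

lemma Z_nonzero_exterior:
  assumes G: "finite_multigraph V E ends" and "\<kappa> > 0" "lmin > 0"
    and lam: "\<And>e. e \<in> E \<Longrightarrow> norm (lam e) \<ge> lmin"
    and K: "\<And>v z. v \<in> V \<Longrightarrow> z \<in> exterior \<kappa> \<Longrightarrow> poly (key_poly (deg ends E v) (u v)) z \<noteq> 0"
    and u: "\<And>v. v \<in> V \<Longrightarrow> u v (deg ends E v) \<noteq> 0"
    and x: "\<And>v. v \<in> V \<Longrightarrow> x v \<in> exterior (\<kappa> / sqrt lmin)"
  shows "Z V E ends lam u x \<noteq> 0"
proof -
  interpret finite_multigraph V E ends by fact
  have nz: "norm (x v) > \<kappa> / sqrt lmin" "x v \<noteq> 0" if "v \<in> V" for v
  proof -
    show "norm (x v) > \<kappa> / sqrt lmin" using x[OF that] by (simp add: exterior_def)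
    moreover have "\<kappa> / sqrt lmin > 0" using \<open>\<kappa> > 0\<close> \<open>lmin > 0\<close> by simp
    ultimately show "x v \<noteq> 0" by auto
  qed
  have lnz: "lam e \<noteq> 0" if "e \<in> E" for e using lam[OF that] \<open>lmin > 0\<close> by auto
  have "Z V E ends (\<lambda>e. 1 / lam e) (\<lambda>v j. u v (deg ends E v - j)) (\<lambda>v. 1 / x v) \<noteq> 0"
  proof (rule Z_nonzero_disc[OF G, of "1 / \<kappa>" "1 / lmin"])
    show "norm (1 / lam e) \<le> 1 / lmin" if "e \<in> E" for e
      using lam[OF that] \<open>lmin > 0\<close> lnz[OF that] by (simp add: norm_divide frac_le)
    show "1 / x v \<in> disc (1 / \<kappa> / sqrt (1 / lmin))" if "v \<in> V" for v
    proof -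
      have "1 / norm (x v) < 1 / (\<kappa> / sqrt lmin)"
        using nz[OF that] \<open>\<kappa> > 0\<close> \<open>lmin > 0\<close> by (intro divide_strict_left_mono) auto
      then show ?thesis by (simp add: disc_def norm_divide real_sqrt_divide)
    qed
    fix v z assume v: "v \<in> V" and z: "z \<in> disc (1 / \<kappa>)"
    show "poly (key_poly (deg ends E v) (\<lambda>j. u v (deg ends E v - j))) z \<noteq> 0"
    \<comment> \<open>At 0, the image of infinity, the reversed key polynomial has the value
      \<open>u v (deg ends E v)\<close>, the top activity.\<close>
    proof (cases "z = 0")
      case True
      then show ?thesis using u[OF v] by (simp add: poly_0_coeff_0 coeff_key_poly)
    next
      case False
      then have "1 / z \<in> exterior \<kappa>"
        using z \<open>\<kappa> > 0\<close> by (simp add: disc_def exterior_def norm_divide field_simps)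
      then show ?thesis using K[OF v] False by (simp add: poly_key_poly_rev)
    qed
  qed (use \<open>\<kappa> > 0\<close> \<open>lmin > 0\<close> in auto)
  then show ?thesis
    using lnz nz finite_E finite_V by (subst Z_complement[OF G]) auto
qed

section \<open>Sectors, part (a), through translation and Hurwitz's theorem\<close>

text \<open>For \<open>j \<le> d\<close> this is (d - j)! / d! times the \<open>j\<close>-th
  derivative of the key polynomial at \<open>\<epsilon>\<close>, so by Taylor expansion these are
  the activities of K(z + \<epsilon>).\<close>

definition translate_activities :: "complex \<Rightarrow> nat \<Rightarrow> (nat \<Rightarrow> complex) \<Rightarrow> nat \<Rightarrow> complex" where
  "translate_activities \<epsilon> d u j = poly (key_poly (d - j) (\<lambda>i. u (j + i))) \<epsilon>"

lemma translate_activities_0: "translate_activities 0 d u = u"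
  by (rule ext) (simp add: translate_activities_def poly_0_coeff_0 coeff_key_poly)

lemma continuous_on_translate_activities:
  "continuous_on A f \<Longrightarrow> continuous_on A (\<lambda>x. translate_activities (f x) d u j)"
  unfolding translate_activities_def by (rule continuous_on_poly)

lemma poly_key_poly_translate_activities:
  "poly (key_poly d (translate_activities \<epsilon> d u)) z = poly (key_poly d u) (z + \<epsilon>)"
proof (induction d arbitrary: u)
  case 0
  show ?case by (simp add: key_poly_def translate_activities_def poly_monom)
next
  case (Suc d)
  let ?u' = "\<lambda>j. u (Suc j)"
  have "translate_activities \<epsilon> (Suc d) u j =
      translate_activities \<epsilon> d u j + \<epsilon> * translate_activities \<epsilon> d ?u' j" if "j \<le> d" for j
    using that by (simp add: translate_activities_def Suc_diff_le key_poly_Suc)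
  then have "key_poly d (translate_activities \<epsilon> (Suc d) u) =
      key_poly d (\<lambda>j. translate_activities \<epsilon> d u j + \<epsilon> * translate_activities \<epsilon> d ?u' j)"
    by (rule key_poly_cong)
  moreover have "translate_activities \<epsilon> (Suc d) u (Suc j) = translate_activities \<epsilon> d ?u' j" for j
    by (simp add: translate_activities_def)
  ultimately show ?case
    by (simp add: key_poly_Suc key_poly_add_smult Suc algebra_simps)
qed

text \<open>Growing balls tangent to the line Re (\<omega> z) = - \<delta> exhaust the open
  half-plane that it bounds, so one of them contains the finite set.\<close>

lemma finite_halfplane_subset_ball:
  fixes \<omega> :: complex
  assumes "finite Y" "\<And>z. z \<in> Y \<Longrightarrow> Re (\<omega> * z) \<ge> 0" "norm \<omega> = 1" "\<delta> > 0"
  obtains c r where "r > 0" "Y \<subseteq> ball c r" "\<And>z. z \<in> ball c r \<Longrightarrow> Re (\<omega> * z) > - \<delta>"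
proof -
  obtain M where M: "\<And>z. z \<in> Y \<Longrightarrow> norm z \<le> M"
    using finite_imp_bounded[OF assms(1)] unfolding bounded_iff by blast
  \<comment> \<open>Chosen so that w = \<omega> z with |w| \<le> M and Re w \<ge> 0 satisfies |w -
    R|^2 \<le> M^2 + R^2 = R \<delta> + R^2 < (R + \<delta>)^2.\<close>
  define R where "R = M\<^sup>2 / \<delta>"
  have R: "R \<ge> 0" "R * \<delta> = M\<^sup>2" using assms(4) by (simp_all add: R_def)
  define c where "c = of_real R * cnj \<omega>"
  have "\<omega> * cnj \<omega> = 1" using assms(3) by (simp add: complex_norm_square[symmetric])
  then have \<omega>c: "\<omega> * c = of_real R" by (simp add: c_def mult.left_commute)
  have eq: "norm (z - c) = norm (\<omega> * z - of_real R)" for z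
    using assms(3) norm_mult[of \<omega> "z - c"] by (simp add: algebra_simps \<omega>c)
  show thesis
  proof (rule that[of "R + \<delta>" c])
    show "R + \<delta> > 0" using R assms(4) by linarith
    show "Y \<subseteq> ball c (R + \<delta>)"
    proof
      fix z assume z: "z \<in> Y"
      let ?w = "\<omega> * z"
      have "norm ?w \<le> M" using M[OF z] assms(3) by (simp add: norm_mult)
      then have "(norm ?w)\<^sup>2 \<le> R * \<delta>" unfolding R by (rule power_mono) simp
      moreover have "(norm (?w - of_real R))\<^sup>2 = (norm ?w)\<^sup>2 - 2 * (R * Re ?w) + R\<^sup>2"
        unfolding cmod_power2 by (simp add: power2_eq_square algebra_simps)
      moreover have "R * Re ?w \<ge> 0" using R(1) assms(2)[OF z] by (intro mult_nonneg_nonneg)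
      moreover have "(R + \<delta>)\<^sup>2 = R\<^sup>2 + 2 * (R * \<delta>) + \<delta>\<^sup>2" "\<delta>\<^sup>2 > 0" "R * \<delta> \<ge> 0"
        using assms(4) R by (simp_all add: power2_eq_square algebra_simps)
      ultimately have "(norm (?w - of_real R))\<^sup>2 < (R + \<delta>)\<^sup>2" by linarith
      then have "norm (?w - of_real R) < R + \<delta>"
        using \<open>R + \<delta> > 0\<close> by (meson less_imp_le power2_less_imp_less)
      then show "z \<in> ball c (R + \<delta>)" by (simp add: dist_norm norm_minus_commute[of c] eq)
    qed
    fix z assume "z \<in> ball c (R + \<delta>)"
    then have "norm (of_real R - \<omega> * z) < R + \<delta>"
      by (simp add: dist_norm norm_minus_commute[of c] eq norm_minus_commute[of "of_real R"])
    then have "Re (of_real R - \<omega> * z) < R + \<delta>" using complex_Re_le_cmod le_less_trans by blast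
    then show "Re (\<omega> * z) > - \<delta>" by simp
  qed
qed

text \<open>The open half-plane around the ray of \<open>x\<close> consists of the directions within
  pi/2 of \<open>Arg x\<close>, and pi/2 + (pi/2 - \<alpha>) = pi - \<alpha>. Otherwise the
  arguments would differ by strictly between pi/2 and 3 pi/2, where the cosine is negative.\<close>

lemma sector_if_Re_pos:
  assumes \<alpha>: "0 \<le> \<alpha>" "\<alpha> < pi / 2" and x: "x \<in> sector (pi / 2 - \<alpha>)"
    and w: "Re (cnj x * w) > 0"
  shows "w \<in> sector (pi - \<alpha>)"
proof -
  have nz: "x \<noteq> 0" "w \<noteq> 0" using w by auto
  have "cnj x * w = rcis (norm x * norm w) (Arg w - Arg x)"
    by (metis (no_types, lifting) rcis_cmod_Arg rcis_cnj rcis_mult uminus_add_conv_diff)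
  then have "0 < norm x * norm w * cos (Arg w - Arg x)" using w by simp
  then have cos: "cos (Arg w - Arg x) > 0" by (rule zero_less_mult_pos) (use nz in simp)
  have Ax: "\<bar>Arg x\<bar> < pi / 2 - \<alpha>" using x by (simp add: sector_def)
  have Aw: "\<bar>Arg w\<bar> \<le> pi" using Arg_bounded[of w] by auto
  have "\<bar>Arg w\<bar> < pi - \<alpha>"
  proof (rule ccontr)
    assume "\<not> ?thesis"
    then have "pi / 2 < \<bar>Arg w - Arg x\<bar>" "\<bar>Arg w - Arg x\<bar> < 3 * pi / 2"
      using Ax Aw \<alpha> by linarith+
    then have "cos \<bar>Arg w - Arg x\<bar> < 0" by (rule cos_lt_zero_pi)
    then show False using cos by simp
  qed
  then show ?thesis using nz by (simp add: sector_def)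
qed

lemma Re_pos_if_sector:
  assumes "0 \<le> \<alpha>" "x \<in> sector (pi / 2 - \<alpha>)"
  shows "Re x > 0"
proof -
  have "\<bar>Arg x\<bar> < pi / 2" "x \<noteq> 0" using assms by (auto simp: sector_def)
  then have "cos (Arg x) > 0" by (intro cos_gt_zero_pi) auto
  then have "norm x * cos (Arg x) > 0" using \<open>x \<noteq> 0\<close> by simp
  then show ?thesis by (metis Re_rcis rcis_cmod_Arg)
qed

lemma open_sector:
  assumes "0 \<le> \<alpha>"
  shows "open (sector (pi / 2 - \<alpha>))"
proof -
  have eq: "sector (pi / 2 - \<alpha>) = {x. Re x > 0} \<inter> (Arg -` {- (pi / 2 - \<alpha>) <..< pi / 2 - \<alpha>})"
    using Re_pos_if_sector[OF assms] by (auto simp: sector_def)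
  have "continuous_on {x. Re x > 0} Arg"
    by (rule continuous_on_subset[OF continuous_on_Arg]) (auto elim!: nonpos_Reals_cases)
  then show ?thesis
    unfolding eq by (rule continuous_open_preimage) (auto simp: open_halfspace_Re_gt)
qed

text \<open>The points \<open>x v * y\<close> fill a closed half-plane with 0 on its boundary.
  Translation by \<epsilon> > 0 pushes the boundary of the zero-free half-plane strictly beyond it,
  leaving room for a ball around finitely many such points.\<close>

lemma Z_nonzero_translate_activities:
  assumes G: "finite_multigraph V E ends" and \<alpha>: "0 \<le> \<alpha>" "\<alpha> < pi / 2" and "\<epsilon> > 0"
    and lam: "\<And>e. e \<in> E \<Longrightarrow> lam e \<in> \<real>\<^sub>\<ge>\<^sub>0"
    and K: "\<And>v z. v \<in> V \<Longrightarrow> z \<in> sector (pi - \<alpha>) \<Longrightarrow> poly (key_poly (deg ends E v) (u v)) z \<noteq> 0"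
    and x: "\<And>v. v \<in> V \<Longrightarrow> x v \<in> sector (pi / 2 - \<alpha>)"
  shows "Z V E ends lam (\<lambda>v. translate_activities (of_real \<epsilon>) (deg ends E v) (u v)) x \<noteq> 0"
proof (rule Z_nonzero[OF G])
  show "contractive {y. Re y \<ge> 0} (lam e)" if "e \<in> E" for e
    by (rule contractive_halfplane[OF lam[OF that]])
  have "(0 :: complex) \<in> {y. Re y \<ge> 0}" by simp
  then show "{y. Re y \<ge> 0} \<noteq> ({} :: complex set)" by blast
  fix v Y assume v: "v \<in> V" and Y: "finite Y" "Y \<subseteq> {y. Re y \<ge> 0}"
  \<comment> \<open>Rotates \<open>x v\<close> to the positive real axis, so Re (\<omega> * (x v *
    y)) has the sign of Re y.\<close>
  define \<omega> where "\<omega> = cnj (sgn (x v))"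
  have xv: "x v \<noteq> 0" "Re (x v) > 0" using Re_pos_if_sector[OF \<alpha>(1) x[OF v]] by auto
  have \<omega>: "norm \<omega> = 1" using xv by (simp add: \<omega>_def norm_sgn)
  have "\<omega> * x v = of_real (norm (x v))"
    using xv complex_norm_square[of "x v"]
    by (simp add: \<omega>_def sgn_div_norm scaleR_conv_of_real field_simps power2_eq_square)
  then have Re\<omega>: "Re (\<omega> * (x v * y)) = norm (x v) * Re y" for y
    by (simp add: mult.assoc[symmetric])
  have pos: "Re (cnj (x v) * w) > 0" if "Re (\<omega> * w) > 0" for w
  proof -
    have "cnj (x v) = of_real (norm (x v)) * \<omega>"
      using xv by (simp add: \<omega>_def sgn_div_norm scaleR_conv_of_real)
    then have "Re (cnj (x v) * w) = norm (x v) * Re (\<omega> * w)" by (simp add: algebra_simps)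
    then show ?thesis using that xv by simp
  qed
  \<comment> \<open>The distance by which the boundary moves, as Re (\<omega> (z + \<epsilon>)) = Re
    (\<omega> z) + \<epsilon> Re \<omega>; it is positive because \<open>x v\<close> lies in the
    open right half-plane.\<close>
  have \<delta>: "\<epsilon> * Re \<omega> > 0" using xv \<open>\<epsilon> > 0\<close> by (simp add: \<omega>_def sgn_div_norm)
  have Y': "Re (\<omega> * z) \<ge> 0" if "z \<in> (*) (x v) ` Y" for z
    using that Y(2) Re\<omega> by (auto simp del: times_complex.sel)
  obtain c r where c: "r > 0" "(*) (x v) ` Y \<subseteq> ball c r"
      "\<And>z. z \<in> ball c r \<Longrightarrow> Re (\<omega> * z) > - (\<epsilon> * Re \<omega>)"
    using finite_halfplane_subset_ball[OF finite_imageI[OF Y(1)] Y' \<omega> \<delta>] by metis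
  have "poly (key_poly (deg ends E v) (u v)) (z + of_real \<epsilon>) \<noteq> 0" if "z \<in> ball c r" for z
  proof -
    have "Re (\<omega> * (z + of_real \<epsilon>)) > 0" using c(3)[OF that] by (simp add: algebra_simps)
    then show ?thesis by (intro K[OF v] sector_if_Re_pos[OF \<alpha> x[OF v]] pos)
  qed
  then show "\<exists>c r. r > 0 \<and> (\<forall>y\<in>Y. x v * y \<in> ball c r) \<and> (\<forall>z\<in>ball c r. poly (key_poly
      (deg ends E v) (translate_activities (of_real \<epsilon>) (deg ends E v) (u v))) z \<noteq> 0)"
    using c(1,2) unfolding poly_key_poly_translate_activities by blast
qed

lemma continuous_on_Z:
  assumes "finite_multigraph V E ends"
    and "\<And>v j. v \<in> V \<Longrightarrow> continuous_on A (\<lambda>p. u p v j)"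
    and "\<And>v. v \<in> V \<Longrightarrow> continuous_on A (\<lambda>p. x p v)"
  shows "continuous_on A (\<lambda>p. Z V E ends lam (u p) (x p))"
  unfolding Z_def using assms(2,3) by (intro continuous_intros) auto

lemma holomorphic_on_Z:
  assumes "finite_multigraph V E ends"
    and "\<And>v. v \<in> V \<Longrightarrow> (\<lambda>p. x p v) holomorphic_on A"
  shows "(\<lambda>p. Z V E ends lam u (x p)) holomorphic_on A"
  unfolding Z_def using assms(2) by (intro holomorphic_intros) auto

text \<open>Joint continuity is uniform on the compact set \<open>{0..1} \<times> K\<close>, which
  gives the uniform convergence that Hurwitz's theorem needs.\<close>

lemma uniform_limit_if_jointly_continuous:
  fixes f :: "real \<Rightarrow> complex \<Rightarrow> complex"
  assumes "compact K" "continuous_on ({0..1} \<times> K) (\<lambda>(s, t). f s t)"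
  shows "uniform_limit K (\<lambda>n. f (inverse (real (Suc n)))) (f 0) sequentially"
proof (rule uniform_limitI)
  fix e :: real assume "e > 0"
  have "uniformly_continuous_on ({0..1} \<times> K) (\<lambda>(s, t). f s t)"
    using assms by (intro compact_uniformly_continuous compact_Times) auto
  then obtain d where d: "d > 0" "\<And>p q. p \<in> {0..1} \<times> K \<Longrightarrow> q \<in> {0..1} \<times> K \<Longrightarrow> dist q p < d \<Longrightarrow>
      dist (case q of (s, t) \<Rightarrow> f s t) (case p of (s, t) \<Rightarrow> f s t) < e"
    using \<open>e > 0\<close> unfolding uniformly_continuous_on_def by metis
  have "\<forall>\<^sub>F n in sequentially. inverse (real (Suc n)) < d"
    by (rule order_tendstoD(2)[OF LIMSEQ_inverse_real_of_nat \<open>d > 0\<close>])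
  then show "\<forall>\<^sub>F n in sequentially. \<forall>t\<in>K. dist (f (inverse (real (Suc n))) t) (f 0 t) < e"
  proof eventually_elim
    case (elim n)
    show ?case
    proof
      fix t assume "t \<in> K"
      have "dist (inverse (real (Suc n)), t) (0, t) < d"
        using elim by (simp add: dist_Pair_Pair dist_real_def)
      then show "dist (f (inverse (real (Suc n))) t) (f 0 t) < e"
        using d(2)[of "(0, t)" "(inverse (real (Suc n)), t)"] \<open>t \<in> K\<close>
        by (simp add: inverse_le_1_iff)
    qed
  qed
qed

text \<open>Suppose \<open>Z\<close> vanishes at \<open>p\<close> in the sector but not at
  \<open>z\<close>. On the complex line through both, \<open>Z\<close> is a limit of the translated
  functions, which have no zeros near \<open>p\<close>, and it is not identically zero; Hurwitz's
  theorem then forbids the zero at \<open>p\<close>.\<close>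

lemma nonvanishing_sector:
  fixes lam :: "'e \<Rightarrow> complex" and u :: "'v \<Rightarrow> nat \<Rightarrow> complex"
  assumes G: "finite_multigraph V E ends" and \<alpha>: "0 \<le> \<alpha>" "\<alpha> < pi / 2"
    and lam: "\<And>e. e \<in> E \<Longrightarrow> lam e \<in> \<real>\<^sub>\<ge>\<^sub>0"
    and K: "\<And>v z. v \<in> V \<Longrightarrow> z \<in> sector (pi - \<alpha>) \<Longrightarrow> poly (key_poly (deg ends E v) (u v)) z \<noteq> 0"
  shows "nonvanishing (sector (pi / 2 - \<alpha>)) V (Z V E ends lam u)"
  unfolding nonvanishing_def
proof (rule disjCI, intro allI impI notI)
  fix z assume "\<not> (\<forall>z. (\<forall>v\<in>V. z v \<in> sector (pi / 2 - \<alpha>)) \<longrightarrow> Z V E ends lam u z \<noteq> 0)"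
  then obtain p where p: "\<And>v. v \<in> V \<Longrightarrow> p v \<in> sector (pi / 2 - \<alpha>)" "Z V E ends lam u p = 0"
    by blast
  show "Z V E ends lam u z = 0"
  proof (rule ccontr)
    assume nz: "Z V E ends lam u z \<noteq> 0"
    \<comment> \<open>The line has \<open>p\<close> at t = 0 and \<open>z\<close> at t = 1, reducing
      the problem to one variable.\<close>
    define x where "x t v = p v + t * (z v - p v)" for t v
    define f where "f s t = Z V E ends lam
      (\<lambda>v. translate_activities (of_real s) (deg ends E v) (u v)) (x t)" for s :: real and t
    have f0: "f 0 t = Z V E ends lam u (x t)" for t
      by (simp add: f_def translate_activities_0)
    have "x 0 = p" "x 1 = z" by (auto simp: x_def)
    have hol: "f s holomorphic_on A" for s A
      unfolding f_def x_def by (intro holomorphic_on_Z[OF G] holomorphic_intros)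
    have cont: "continuous_on A (\<lambda>(s, t). f s t)" for A
      unfolding f_def x_def split_def
      by (intro continuous_on_Z[OF G] continuous_on_translate_activities continuous_intros)
    define U where "U = {t. \<forall>v\<in>V. x t v \<in> sector (pi / 2 - \<alpha>)}"
    have "open U"
    proof -
      have "U = (\<Inter>v\<in>V. (\<lambda>t. x t v) -` sector (pi / 2 - \<alpha>))" by (auto simp: U_def)
      moreover have "open ((\<lambda>t. x t v) -` sector (pi / 2 - \<alpha>))" for v
        unfolding x_def by (intro open_vimage open_sector \<alpha> continuous_intros)
      ultimately show ?thesis using finite_multigraph.finite_V[OF G] by auto
    qed
    moreover have "0 \<in> U" using p(1) by (simp add: U_def \<open>x 0 = p\<close>)
    ultimately obtain \<rho> where \<rho>: "\<rho> > 0" "ball 0 \<rho> \<subseteq> U" by (rule openE)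
    have "f 0 0 \<noteq> 0"
    proof (rule Hurwitz_no_zeros[of "ball 0 \<rho>" "\<lambda>n. f (inverse (real (Suc n)))" "f 0" 0])
      show "f (inverse (real (Suc n))) t \<noteq> 0" if "t \<in> ball 0 \<rho>" for n t
        unfolding f_def
      proof (rule Z_nonzero_translate_activities[OF G \<alpha> _ lam K])
        show "x t v \<in> sector (pi / 2 - \<alpha>)" if "v \<in> V" for v
          using that \<rho>(2) \<open>t \<in> ball 0 \<rho>\<close> by (auto simp: U_def)
      qed auto
      \<comment> \<open>A constant value on the ball would be \<open>f 0 0 = 0\<close>; the identity
        theorem would carry it to t = 1, where \<open>Z\<close> is nonzero.\<close>
      show "\<not> f 0 constant_on ball 0 \<rho>"
      proof
        assume "f 0 constant_on ball 0 \<rho>"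
        then have "f 0 t = f 0 0" if "t \<in> ball 0 \<rho>" for t
          using that \<rho>(1) unfolding constant_on_def by force
        then have zero: "f 0 t = 0" if "t \<in> ball 0 \<rho>" for t
          using that p(2) f0 \<open>x 0 = p\<close> by simp
        have "0 islimpt ball (0 :: complex) \<rho>" using \<rho>(1) by (simp add: islimpt_ball)
        then have "f 0 1 = 0"
          by (rule analytic_continuation[OF hol open_UNIV connected_UNIV subset_UNIV UNIV_I])
            (simp_all only: zero UNIV_I)
        then show False using nz f0 \<open>x 1 = z\<close> by simp
      qed
      show "uniform_limit K (\<lambda>n. f (inverse (real (Suc n)))) (f 0) sequentially" if "compact K" for K
        by (rule uniform_limit_if_jointly_continuous[OF that cont])
    qed (use hol \<rho>(1) in auto)
    then show False using p(2) f0 \<open>x 0 = p\<close> by simp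
  qed
qed

section \<open>Assembly of the three parts\<close>

theorem theorem3p2:
  fixes V :: "'v set" and E :: "'e set" and ends :: "'e \<Rightarrow> 'v multiset"
    and lam :: "'e \<Rightarrow> complex" and u :: "'v \<Rightarrow> nat \<Rightarrow> complex"
  assumes "finite_multigraph V E ends"
  shows
    "(\<forall>\<alpha>::real. 0 \<le> \<alpha> \<and> \<alpha> < pi / 2 \<longrightarrow>
        (\<forall>e\<in>E. lam e \<in> \<real>\<^sub>\<ge>\<^sub>0) \<longrightarrow>
        (\<forall>v\<in>V. poly_nonvanishing (sector (pi - \<alpha>)) (key_poly (deg ends E v) (u v))) \<longrightarrow>
        nonvanishing (sector (pi / 2 - \<alpha>)) V (Z V E ends lam u))
   \<and> (\<forall>(\<kappa>::real) (lmax::real). \<kappa> > 0 \<and> lmax > 0 \<longrightarrow>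
        (\<forall>e\<in>E. norm (lam e) \<le> lmax) \<longrightarrow>
        (\<forall>v\<in>V. poly_nonvanishing (disc \<kappa>) (key_poly (deg ends E v) (u v))) \<longrightarrow>
        nonvanishing (disc (\<kappa> / sqrt lmax)) V (Z V E ends lam u))
   \<and> (\<forall>(\<kappa>::real) (lmin::real). \<kappa> > 0 \<and> lmin > 0 \<longrightarrow>
        (\<forall>e\<in>E. norm (lam e) \<ge> lmin) \<longrightarrow>
        (\<forall>v\<in>V. poly_nonvanishing (exterior \<kappa>) (key_poly (deg ends E v) (u v)) \<and>
                degree (key_poly (deg ends E v) (u v)) = deg ends E v) \<longrightarrow>
        nonvanishing (exterior (\<kappa> / sqrt lmin)) V (Z V E ends lam u))"
proof (intro conjI allI impI)
  note reduce = nonvanishing_if_all_key_poly_nonzero[OF assms]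
  note G = assms
  show "nonvanishing (sector (pi / 2 - \<alpha>)) V (Z V E ends lam u)"
    if "0 \<le> \<alpha> \<and> \<alpha> < pi / 2" "\<forall>e\<in>E. lam e \<in> \<real>\<^sub>\<ge>\<^sub>0"
      "\<forall>v\<in>V. poly_nonvanishing (sector (pi - \<alpha>)) (key_poly (deg ends E v) (u v))" for \<alpha>
  proof (rule reduce)
    assume nz: "\<And>v. v \<in> V \<Longrightarrow> key_poly (deg ends E v) (u v) \<noteq> 0"
    show ?thesis
      using that nz by (intro nonvanishing_sector[OF G]) (auto simp: poly_nonvanishing_iff)
  qed
  show "nonvanishing (disc (\<kappa> / sqrt lmax)) V (Z V E ends lam u)"
    if "\<kappa> > 0 \<and> lmax > 0" "\<forall>e\<in>E. norm (lam e) \<le> lmax"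
      "\<forall>v\<in>V. poly_nonvanishing (disc \<kappa>) (key_poly (deg ends E v) (u v))" for \<kappa> lmax
  proof (rule reduce)
    assume nz: "\<And>v. v \<in> V \<Longrightarrow> key_poly (deg ends E v) (u v) \<noteq> 0"
    have "Z V E ends lam u x \<noteq> 0" if "\<forall>v\<in>V. x v \<in> disc (\<kappa> / sqrt lmax)" for x
      using \<open>\<kappa> > 0 \<and> lmax > 0\<close> \<open>\<forall>e\<in>E. _\<close> \<open>\<forall>v\<in>V. poly_nonvanishing _ _\<close> nz that
      by (intro Z_nonzero_disc[OF G, of \<kappa> lmax]) (auto simp: poly_nonvanishing_iff)
    then show ?thesis by (auto simp: nonvanishing_def)
  qed
  show "nonvanishing (exterior (\<kappa> / sqrt lmin)) V (Z V E ends lam u)"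
    if "\<kappa> > 0 \<and> lmin > 0" "\<forall>e\<in>E. norm (lam e) \<ge> lmin"
      "\<forall>v\<in>V. poly_nonvanishing (exterior \<kappa>) (key_poly (deg ends E v) (u v)) \<and>
        degree (key_poly (deg ends E v) (u v)) = deg ends E v" for \<kappa> lmin
  proof (rule reduce)
    assume nz: "\<And>v. v \<in> V \<Longrightarrow> key_poly (deg ends E v) (u v) \<noteq> 0"
    \<comment> \<open>The exact degree makes the top activity the leading coefficient, which is
      nonzero since the key polynomial is; in degree 0 the degree condition alone would not exclude
      zero.\<close>
    have "u v (deg ends E v) \<noteq> 0" if "v \<in> V" for v
    proof -
      have "coeff (key_poly (deg ends E v) (u v)) (deg ends E v) \<noteq> 0"
        using nz[OF that] \<open>\<forall>v\<in>V. poly_nonvanishing _ _ \<and> _\<close> that by (metis leading_coeff_0_iff)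
      then show ?thesis by (simp add: coeff_key_poly)
    qed
    then have "Z V E ends lam u x \<noteq> 0" if "\<forall>v\<in>V. x v \<in> exterior (\<kappa> / sqrt lmin)" for x
      using \<open>\<kappa> > 0 \<and> lmin > 0\<close> \<open>\<forall>e\<in>E. _\<close> \<open>\<forall>v\<in>V. poly_nonvanishing _ _ \<and> _\<close> nz that
      by (intro Z_nonzero_exterior[OF G, of \<kappa> lmin]) (auto simp: poly_nonvanishing_iff)
    then show ?thesis by (auto simp: nonvanishing_def)
  qed
qed

end
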